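(* Let $n\ge2$ be an integer. A non-zero non-unit $p\in n\mathrm{Ell}(\mathbb{Z})$ is $\circ_n$-prime if and only if $|\Sigma_n(p)|$ is a classical prime number. In this case, $|\Sigma_n(p)|\equiv\pm1\pmod{n+1}$.
   Context: $n\mathrm{Ell}(\mathbb{Z})$ is the set $\mathbb{Z}$ with the $n$-ary operation $a_1\ast\cdots\ast a_n:=1-\sum_{i=1}^n a_i$ and the commutative monoid operation $a\circ_n b:=a+b-(n+1)ab$ with identity $0$. The norm is $\Sigma_n(a):=1-(n+1)a\in\mathbb{Z}$. Units are taken with respect to $\circ_n$. We write $p\mid_n a$ if $a=p\circ_n r$ for some $r\in\mathbb{Z}$. A non-unit $p$ is $\circ_n$-prime if $p\mid_n a\circ_n b$ implies $p\mid_n a$ or $p\mid_n b$. *)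

theory Defs
  imports "HOL-Algebra.Divisibility" "HOL-Number_Theory.Cong"
begin

text \<open>The commutative monoid carried by \<open>nEll(\<int>)\<close>. Units, divisibility and primality refer to
  this operation only, so the \<open>n\<close>-ary operation \<open>1 - (a\<^sub>1 + \<dots> + a\<^sub>n)\<close> is not recorded.\<close>

definition nEll :: "nat \<Rightarrow> int monoid" where
  "nEll n = \<lparr>carrier = UNIV, mult = (\<lambda>a b. a + b - (int n + 1) * a * b), one = 0\<rparr>"

definition Sigma_norm :: "nat \<Rightarrow> int \<Rightarrow> int" where
  "Sigma_norm n a = 1 - (int n + 1) * a"

lemma comm_monoid_nEll: "comm_monoid (nEll n)"
  by (rule comm_monoidI) (auto simp: nEll_def algebra_simps)

text \<open>The name \<open>prime\<close> is shared by two library constants: \<open>Divisibility.prime\<close>, which is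
  relative to a monoid, and \<open>Factorial_Ring.prime\<close>, the classical primes of \<open>\<int>\<close>.\<close>

abbreviation circ_prime :: "nat \<Rightarrow> int \<Rightarrow> bool" where
  "circ_prime n p \<equiv> Divisibility.prime (nEll n) p"

end

theory Submission imports Defs begin

text \<open>
  Write \<open>m = n + 1\<close>. The norm \<open>a \<mapsto> 1 - m a\<close> is an injective monoid homomorphism from \<open>nEll(\<int>)\<close>
  to \<open>(\<int>, \<cdot>)\<close> whose image is the Hilbert monoid of all integers congruent to \<open>1\<close> modulo \<open>m\<close>.
  If \<open>s\<close> and \<open>s t\<close> are both congruent to \<open>1\<close>, then so is \<open>t\<close>, so divisibility in the Hilbert
  monoid is the restriction of divisibility in \<open>\<int>\<close>. Hence \<open>p\<close> is \<open>\<circ>\<^sub>n\<close>-prime as soon as the norm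
  of \<open>p\<close> is a prime element of \<open>\<int>\<close>.

  The converse has to rule out that a product \<open>s = x y\<close> in \<open>\<int>\<close> goes unnoticed in the Hilbert
  monoid because \<open>x\<close> and \<open>y\<close> lie outside it. Both factors are coprime to \<open>m\<close>, since \<open>s\<close> is, and
  therefore both can be multiplied into the residue class of \<open>1\<close> modulo \<open>m\<close> by factors that are
  congruent to \<open>1\<close> modulo \<open>s\<close> (\<open>multiple_cong_one\<close>, by the Chinese remainder theorem). The
  adjusted factors have a product divisible by \<open>s\<close>, so primality in the Hilbert monoid makes \<open>s\<close>
  divide one of them, and thus \<open>x\<close> or \<open>y\<close>. This shows that \<open>s\<close> is irreducible in \<open>\<int>\<close>, and so
  prime.

  The congruence holds for every norm, because \<open>s \<equiv> 1\<close> and \<open>\<bar>s\<bar> = \<plusminus>s\<close>.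
\<close>

lemma Sigma_norm_mult:
  "Sigma_norm n (a \<otimes>\<^bsub>nEll n\<^esub> b) = Sigma_norm n a * Sigma_norm n b"
  by (simp add: Sigma_norm_def nEll_def algebra_simps)

lemma inj_Sigma_norm: "inj (Sigma_norm n)"
proof (rule injI)
  fix a b assume "Sigma_norm n a = Sigma_norm n b"
  then have "(int n + 1) * a = (int n + 1) * b"
    by (simp add: Sigma_norm_def)
  moreover have "int n + 1 \<noteq> 0"
    by linarith
  ultimately show "a = b"
    by simp
qed

lemma cong_Sigma_norm: "[Sigma_norm n a = 1] (mod (int n + 1))"
  by (simp add: Sigma_norm_def cong_iff_dvd_diff)

lemma ex_Sigma_norm:
  assumes "[x = 1] (mod (int n + 1))"
  obtains a where "Sigma_norm n a = x"
proof -
  from assms have "int n + 1 dvd 1 - x"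
    by (simp add: cong_iff_dvd_diff dvd_diff_commute)
  then obtain a where "1 - x = (int n + 1) * a"
    by (rule dvdE)
  then have "Sigma_norm n a = x"
    by (simp add: Sigma_norm_def)
  then show thesis
    by (rule that)
qed

lemma coprime_Sigma_norm: "coprime (Sigma_norm n a) (int n + 1)"
  by (rule cong_imp_coprime[OF cong_sym[OF cong_Sigma_norm] coprime_1_left])

text \<open>If one norm divides another in \<open>\<int>\<close>, then the quotient is again congruent to \<open>1\<close> modulo
  \<open>n + 1\<close>, so it is a norm as well.\<close>

lemma divides_nEll_iff:
  "a divides\<^bsub>nEll n\<^esub> b \<longleftrightarrow> Sigma_norm n a dvd Sigma_norm n b"
proof
  assume "a divides\<^bsub>nEll n\<^esub> b"
  then obtain c where "b = a \<otimes>\<^bsub>nEll n\<^esub> c"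
    by (auto simp: factor_def)
  then show "Sigma_norm n a dvd Sigma_norm n b"
    by (simp add: Sigma_norm_mult)
next
  assume "Sigma_norm n a dvd Sigma_norm n b"
  then obtain t where t: "Sigma_norm n b = Sigma_norm n a * t"
    by (rule dvdE)
  have "[1 * t = Sigma_norm n a * t] (mod (int n + 1))"
    by (intro cong_mult cong_refl cong_sym[OF cong_Sigma_norm])
  also have "[Sigma_norm n a * t = 1] (mod (int n + 1))"
    using cong_Sigma_norm[of n b] by (simp add: t)
  finally have "[t = 1] (mod (int n + 1))"
    by simp
  then obtain c where "Sigma_norm n c = t"
    by (rule ex_Sigma_norm)
  with t have "Sigma_norm n b = Sigma_norm n (a \<otimes>\<^bsub>nEll n\<^esub> c)"
    by (simp add: Sigma_norm_mult)
  then have "b = a \<otimes>\<^bsub>nEll n\<^esub> c"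
    by (rule injD[OF inj_Sigma_norm])
  then show "a divides\<^bsub>nEll n\<^esub> b"
    by (auto simp: factor_def nEll_def)
qed

lemma circ_prime_iff:
  "circ_prime n p \<longleftrightarrow> p \<notin> Units (nEll n) \<and>
    (\<forall>a b. Sigma_norm n p dvd Sigma_norm n a * Sigma_norm n b \<longrightarrow>
      Sigma_norm n p dvd Sigma_norm n a \<or> Sigma_norm n p dvd Sigma_norm n b)"
proof -
  have "carrier (nEll n) = UNIV"
    by (simp add: nEll_def)
  then show ?thesis
    by (simp add: Divisibility.prime_def divides_nEll_iff Sigma_norm_mult)
qed

text \<open>Since \<open>- 1\<close> is congruent to \<open>1\<close> modulo \<open>n + 1\<close> only for \<open>n \<le> 1\<close>, the only norm that is a
  unit of \<open>\<int>\<close> is \<open>1\<close>.\<close>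

lemma is_unit_Sigma_norm_iff:
  assumes "n \<ge> 2"
  shows "is_unit (Sigma_norm n a) \<longleftrightarrow> a = 0"
proof
  assume "is_unit (Sigma_norm n a)"
  then consider "Sigma_norm n a = 1" | "Sigma_norm n a = - 1"
    by (auto simp: zdvd1_eq abs_if split: if_splits)
  then show "a = 0"
  proof cases
    case 1
    then show ?thesis
      by (auto simp: Sigma_norm_def)
  next
    case 2
    then have "int n + 1 dvd 2"
      by (auto simp: Sigma_norm_def intro!: dvdI[of _ _ a])
    then have "int n + 1 \<le> 2"
      by (rule zdvd_imp_le) simp
    with assms show ?thesis
      by simp
  qed
qed (simp add: Sigma_norm_def)

text \<open>An integer coprime to \<open>m\<close> has a multiple in the residue class of \<open>1\<close> modulo \<open>m\<close> that is
  unchanged modulo any given \<open>s\<close> coprime to \<open>m\<close>, and so is divisible by \<open>s\<close> only if the original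
  integer is.\<close>

lemma multiple_cong_one:
  fixes m s x :: int
  assumes "coprime s m" and "coprime x m"
  obtains a where "x dvd a" and "[a = 1] (mod m)" and "[a = x] (mod s)"
proof -
  obtain w where w: "[x * w = 1] (mod m)"
    using cong_solve_coprime_int[OF assms(2)] by blast
  obtain u where u: "[u = w] (mod m)" "[u = 1] (mod s)"
    using binary_chinese_remainder_int[of m s w 1] assms(1) by (auto simp: coprime_commute)
  show thesis
  proof
    show "x dvd x * u"
      by simp
    show "[x * u = 1] (mod m)"
      using cong_trans[OF cong_mult[OF cong_refl u(1)] w] .
    show "[x * u = x] (mod s)"
      using cong_mult[OF cong_refl u(2), of x] by simp
  qed
qed

text \<open>The factors \<open>x\<close> and \<open>y\<close> of a norm need not be norms themselves; primality is applied to
  multiples of them that are norms and agree with \<open>x\<close> and \<open>y\<close> modulo the norm of \<open>p\<close>.\<close>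

lemma irreducible_Sigma_norm:
  assumes "n \<ge> 2" and "p \<noteq> 0" and "circ_prime n p"
  shows "irreducible (Sigma_norm n p)"
proof (rule irreducibleI)
  let ?s = "Sigma_norm n p" and ?m = "int n + 1"
  show "\<not> is_unit ?s"
    using assms(2) unfolding is_unit_Sigma_norm_iff[OF assms(1)] .
  show nz: "?s \<noteq> 0"
  proof
    assume "?s = 0"
    with coprime_Sigma_norm[of n p] have "is_unit ?m"
      by (simp only: coprime_0_left_iff)
    with assms(1) show False
      by simp
  qed
  fix x y assume s: "?s = x * y"
  have cop: "coprime x ?m" "coprime y ?m"
    using coprime_Sigma_norm[of n p] unfolding s by (simp_all only: coprime_mult_left_iff)
  obtain a where a: "x dvd a" "[a = 1] (mod ?m)" "[a = x] (mod ?s)"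
    by (rule multiple_cong_one[OF coprime_Sigma_norm cop(1)])
  obtain b where b: "y dvd b" "[b = 1] (mod ?m)" "[b = y] (mod ?s)"
    by (rule multiple_cong_one[OF coprime_Sigma_norm cop(2)])
  obtain a' where a': "Sigma_norm n a' = a"
    by (rule ex_Sigma_norm[OF a(2)])
  obtain b' where b': "Sigma_norm n b' = b"
    by (rule ex_Sigma_norm[OF b(2)])
  have "?s dvd a * b"
    unfolding s by (rule mult_dvd_mono[OF a(1) b(1)])
  then have "?s dvd a \<or> ?s dvd b"
    using assms(3) unfolding circ_prime_iff a'[symmetric] b'[symmetric] by blast
  then have "?s dvd x \<or> ?s dvd y"
    by (simp only: cong_dvd_iff[OF a(3)] cong_dvd_iff[OF b(3)])
  then show "is_unit x \<or> is_unit y"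
    using nz dvd_times_left_cancel_iff[of x y 1] dvd_times_right_cancel_iff[of y x 1]
    unfolding s by (metis mult_1_left mult_1_right mult_eq_0_iff)
qed

theorem proposition6p3:
  fixes n :: nat and p :: int
  assumes "n \<ge> 2"
    and "p \<noteq> 0"
    and "p \<notin> Units (nEll n)"
  shows "(circ_prime n p \<longleftrightarrow> Factorial_Ring.prime \<bar>Sigma_norm n p\<bar>) \<and>
    (circ_prime n p \<longrightarrow>
      [\<bar>Sigma_norm n p\<bar> = 1] (mod (int n + 1)) \<or> [\<bar>Sigma_norm n p\<bar> = - 1] (mod (int n + 1)))"
proof (intro conjI impI)
  have prime_iff: "Factorial_Ring.prime \<bar>Sigma_norm n p\<bar> \<longleftrightarrow> prime_elem (Sigma_norm n p)"
    using prime_normalize_iff[of "Sigma_norm n p"] by (simp only: normalize_int_def)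
  show "circ_prime n p \<longleftrightarrow> Factorial_Ring.prime \<bar>Sigma_norm n p\<bar>"
  proof
    assume "circ_prime n p"
    then have "irreducible (Sigma_norm n p)"
      by (rule irreducible_Sigma_norm[OF assms(1,2)])
    then show "Factorial_Ring.prime \<bar>Sigma_norm n p\<bar>"
      unfolding prime_iff by (rule irreducible_imp_prime_elem)
  next
    assume "Factorial_Ring.prime \<bar>Sigma_norm n p\<bar>"
    then have "prime_elem (Sigma_norm n p)"
      by (simp only: prime_iff)
    with assms(3) show "circ_prime n p"
      unfolding circ_prime_iff by (blast dest: prime_elem_dvd_multD)
  qed
next
  show "[\<bar>Sigma_norm n p\<bar> = 1] (mod (int n + 1)) \<or> [\<bar>Sigma_norm n p\<bar> = - 1] (mod (int n + 1))"
    using cong_Sigma_norm[of n p] by (cases "0 \<le> Sigma_norm n p")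
      (simp_all add: cong_minus_minus_iff)
qed

end
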